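(* Let $f\colon\mathbb{R}\to\mathbb{R}$ be a differentiable function and let $T(x)=ax+b$ be an affine map of $\mathbb{R}$, with $a,b\in\mathbb{R}$ and $a\neq 0$. Then, for all $x\in\mathbb{R}$ with $f'(x)\neq 0$, $$\bigl(T\circ M_{f\circ T}\circ T^{-1}\bigr)(x)=M_f(x).$$
   Context: For a differentiable function $h\colon\mathbb{R}\to\mathbb{R}$, the classical Newton's approximation function is $N_h(x)=x-\frac{h(x)}{h'(x)}$, and the modified Newton's approximation function is $M_h(x)=N_h(x)-\frac{h(N_h(x))}{h'(x)}$; both are defined for all $x\in\mathbb{R}$ with $h'(x)\neq 0$. *)

theory Defs
  imports "HOL-Analysis.Analysis"
begin

text \<open>
  Mathematically, both approximation functions are partial: they are defined exactly at the points
  \<open>x\<close> with \<open>deriv h x \<noteq> 0\<close>. Here they are total functions, and their values at points where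
  \<open>deriv h x = 0\<close> (an artefact of \<open>y / 0 = 0\<close>) carry no meaning.
\<close>

definition newton_approx :: "(real \<Rightarrow> real) \<Rightarrow> real \<Rightarrow> real" where
  "newton_approx h x = x - h x / deriv h x"

text \<open>The second step reuses the derivative at \<open>x\<close>, not at \<open>newton_approx h x\<close>.\<close>

definition modified_newton_approx :: "(real \<Rightarrow> real) \<Rightarrow> real \<Rightarrow> real" where
  "modified_newton_approx h x = newton_approx h x - h (newton_approx h x) / deriv h x"

end

theory Submission
  imports Defs
begin

text \<open>By the chain rule the derivative of \<open>f \<circ> T\<close> at \<open>y\<close> is
  \<open>a\<close> times that of \<open>f\<close> at \<open>T y\<close>. Each Newton correction for
  \<open>f \<circ> T\<close> is therefore the one for \<open>f\<close> divided by \<open>a\<close>,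
  and applying \<open>T\<close> multiplies it by \<open>a\<close> again. So \<open>T\<close> carries
  both approximations of \<open>f \<circ> T\<close> at \<open>y\<close> to those of \<open>f\<close>
  at \<open>T y\<close>; the theorem is the case \<open>y = inv T x\<close>.\<close>

lemma deriv_compose_affine:
  fixes f :: "real \<Rightarrow> real"
  assumes "f differentiable (at (a * y + b))"
  shows "deriv (f \<circ> (\<lambda>x. a * x + b)) y = a * deriv f (a * y + b)"
proof -
  have f: "(f has_real_derivative deriv f (a * y + b)) (at (a * y + b))"
    using assms DERIV_deriv_iff_real_differentiable by blast
  have T: "((\<lambda>x. a * x + b) has_real_derivative a) (at y)"
    by (auto intro!: derivative_eq_intros)
  show ?thesis
    using DERIV_chain[OF f T] by (simp add: DERIV_imp_deriv mult.commute)
qed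

lemma affine_newton_approx_compose:
  assumes "f differentiable (at (a * y + b))" "a \<noteq> 0"
  shows "a * newton_approx (f \<circ> (\<lambda>x. a * x + b)) y + b = newton_approx f (a * y + b)"
  using assms by (simp add: newton_approx_def deriv_compose_affine right_diff_distrib)

text \<open>The second numerator is \<open>f\<close> at the \<open>T\<close>-image of the first
  Newton point of \<open>f \<circ> T\<close>, which by the previous lemma is the Newton point of
  \<open>f\<close>.\<close>

lemma affine_modified_newton_approx_compose:
  assumes "f differentiable (at (a * y + b))" "a \<noteq> 0"
  shows "a * modified_newton_approx (f \<circ> (\<lambda>x. a * x + b)) y + b
    = modified_newton_approx f (a * y + b)"
  using assms
  \<comment> \<open>The Newton lemma is used from right to left, since distributing \<open>a\<close>
    separates the summands of its left side.\<close>
  by (simp add: modified_newton_approx_def deriv_compose_affine right_diff_distrib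
      affine_newton_approx_compose [symmetric])

text \<open>The first conjunct ensures that the left side is a genuine value, not an artefact of
  division by zero.\<close>

theorem theorem4p1:
  fixes f T :: "real \<Rightarrow> real" and a b :: real
  assumes "\<And>x. f differentiable (at x)"
    and "T = (\<lambda>x. a * x + b)"
    and "a \<noteq> 0"
  shows "\<forall>x. deriv f x \<noteq> 0 \<longrightarrow>
    deriv (f \<circ> T) (inv T x) \<noteq> 0 \<and>
    (T \<circ> modified_newton_approx (f \<circ> T) \<circ> inv T) x = modified_newton_approx f x"
proof (intro allI impI)
  fix x
  assume nz: "deriv f x \<noteq> 0"
  \<comment> \<open>This preimage puts \<open>x\<close> in the range of \<open>T\<close>, so
    \<open>inv T\<close> is a right inverse there and no formula for it is required.\<close>
  have "x = T ((x - b) / a)"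
    using assms(2,3) by simp
  then have "T (inv T x) = x"
    by (metis f_inv_into_f rangeI)
  then have y: "a * inv T x + b = x"
    using assms(2) by simp
  have "deriv (f \<circ> T) (inv T x) = a * deriv f x"
    using deriv_compose_affine[of f a "inv T x" b] assms(1) y assms(2) by simp
  moreover have "a * modified_newton_approx (f \<circ> T) (inv T x) + b = modified_newton_approx f x"
    using affine_modified_newton_approx_compose[of f a "inv T x" b] assms(1,3) y assms(2) by simp
  ultimately show "deriv (f \<circ> T) (inv T x) \<noteq> 0 \<and>
    (T \<circ> modified_newton_approx (f \<circ> T) \<circ> inv T) x = modified_newton_approx f x"
    using nz assms(2,3) by simp
qed

end
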